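(* Let $A$ be an $n\times n$ real constant matrix with $\mathrm{Re}(\sigma(A))<0$, and let $f:\mathbb{R}^+\times\mathbb{R}^n\to\mathbb{R}^n$ be a nonlinear function. Consider the non-time-changed system $$\mathrm{d}Y(t)=AY(t)\,\mathrm{d}t+f(t,Y(t))\,\mathrm{d}t,\qquad Y(0)=x_0\in\mathbb{R}^n,$$ and the time-changed system $$\mathrm{d}X(t)=AX(t)\,\mathrm{d}E_t+f(E_t,X(t))\,\mathrm{d}E_t,\qquad X(0)=x_0\in\mathbb{R}^n.$$ If the trivial solution of the non-time-changed system is exponentially stable, then, for every $p\ge1$, the trivial solution of the time-changed system is $p$th moment asymptotically stable.
   Context: $U(t)$ is a $\beta$-stable subordinator, $\beta\in(0,1)$: a strictly increasing $\beta$-stable L\'evy process with $\mathbb{E}[\exp(-sU(t))]=\exp(-ts^\beta)$. Its inverse is $E_t=\inf\{s>0:U(s)>t\}$, a continuous nondecreasing process. Differential equations are understood in integral form, with pathwise Lebesgue--Stieltjes integrals with respect to $E_t$. $\sigma(A)$ is the spectrum of $A$, and $\mathrm{Re}(\sigma(A))<0$ means that every eigenvalue of $A$ has negative real part. $X(t)=X_t(x_0)$ and $Y(t)$ denote the solutions with (deterministic) initial value $x_0$; it is assumed that the coefficients vanish at the origin (so $f(t,0)=0$ for all $t\ge0$), so that the zero function is the solution for $x_0=0$ in both systems, called the trivial solution. Definitions. The trivial solution of the non-time-changed system is exponentially stable if there are positive constants $K,\lambda$ such that $\|Y(t)\|\le K\|x_0\|\exp(-\lambda t)$ for all $t\ge0$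 and $x_0\in\mathbb{R}^n$. The trivial solution of the time-changed system is $p$th moment asymptotically stable if there are a function $\nu:[0,\infty)\to[0,\infty)$ decaying to $0$ as $t\to\infty$ and a positive constant $K$ such that $\mathbb{E}\|X_t(x_0)\|^p\le K\|x_0\|^p\nu(t)$ for all $t\ge0$ and $x_0\in\mathbb{R}^n$. *)

theory Defs
  imports "HOL-Probability.Probability"
begin

definition levy_process :: "'a measure \<Rightarrow> (real \<Rightarrow> 'a \<Rightarrow> real) \<Rightarrow> bool" where
  "levy_process M U \<longleftrightarrow>
     (\<forall>t\<ge>0. U t \<in> borel_measurable M) \<and>
     (AE \<omega> in M. U 0 \<omega> = 0) \<and>
     (\<forall>(n::nat) \<tau>::nat \<Rightarrow> real. 0 \<le> \<tau> 0 \<and> mono \<tau> \<longrightarrow>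
        prob_space.indep_vars M (\<lambda>_. borel) (\<lambda>i \<omega>. U (\<tau> (Suc i)) \<omega> - U (\<tau> i) \<omega>) {..<n}) \<and>
     (\<forall>s\<ge>0. \<forall>h\<ge>0. distr M borel (\<lambda>\<omega>. U (s + h) \<omega> - U s \<omega>) = distr M borel (U h)) \<and>
     (\<forall>s\<ge>0. \<forall>\<epsilon>>0.
        ((\<lambda>t. measure M {\<omega> \<in> space M. \<epsilon> < \<bar>U t \<omega> - U s \<omega>\<bar>}) \<longlongrightarrow> 0) (at s within {0..})) \<and>
     (AE \<omega> in M. (\<forall>t\<ge>0. continuous (at_right t) (\<lambda>s. U s \<omega>)) \<and>
                  (\<forall>t>0. \<exists>l. ((\<lambda>s. U s \<omega>) \<longlongrightarrow> l) (at_left t)))"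

definition stable_subordinator :: "'a measure \<Rightarrow> real \<Rightarrow> (real \<Rightarrow> 'a \<Rightarrow> real) \<Rightarrow> bool" where
  "stable_subordinator M \<beta> U \<longleftrightarrow>
     levy_process M U \<and>
     (AE \<omega> in M. strict_mono_on {0..} (\<lambda>t. U t \<omega>)) \<and>
     (\<forall>t\<ge>0. \<forall>s\<ge>0. prob_space.expectation M (\<lambda>\<omega>. exp (- s * U t \<omega>)) = exp (- t * s powr \<beta>))"

text \<open>If a path of \<open>U\<close> is nonnegative, increasing and unbounded, then the infimum is \<open>0\<close> at every
  \<open>t < 0\<close>, so the path of the inverse is nondecreasing and right-continuous on all of \<open>\<real>\<close>, as
  \<^const>\<open>interval_measure\<close> requires to yield its Lebesgue--Stieltjes measure.\<close>

definition inverse_subordinator :: "(real \<Rightarrow> 'a \<Rightarrow> real) \<Rightarrow> real \<Rightarrow> 'a \<Rightarrow> real" where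
  "inverse_subordinator U t \<omega> = Inf {s. 0 < s \<and> t < U s \<omega>}"

text \<open>The eigenvalues of a real matrix are taken over the complex numbers.\<close>

definition spectrum :: "real^'n^'n \<Rightarrow> complex set" where
  "spectrum A = {\<mu>. \<exists>v::complex^'n. v \<noteq> 0 \<and> (\<chi> i j. complex_of_real (A $ i $ j)) *v v = \<mu> *s v}"

definition ode_solution ::
  "real^'n^'n \<Rightarrow> (real \<Rightarrow> real^'n \<Rightarrow> real^'n) \<Rightarrow> real^'n \<Rightarrow> (real \<Rightarrow> real^'n) \<Rightarrow> bool" where
  "ode_solution A f x0 Y \<longleftrightarrow>
     (\<forall>t\<ge>0. set_integrable lborel {0..t} (\<lambda>s. A *v Y s) \<and>
             set_integrable lborel {0..t} (\<lambda>s. f s (Y s)) \<and>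
             Y t = x0 + (LINT s:{0..t}|lborel. A *v Y s) + (LINT s:{0..t}|lborel. f s (Y s)))"

definition time_changed_solution ::
  "'a measure \<Rightarrow> (real \<Rightarrow> 'a \<Rightarrow> real) \<Rightarrow> real^'n^'n \<Rightarrow> (real \<Rightarrow> real^'n \<Rightarrow> real^'n) \<Rightarrow>
   real^'n \<Rightarrow> (real \<Rightarrow> 'a \<Rightarrow> real^'n) \<Rightarrow> bool" where
  "time_changed_solution M E A f x0 X \<longleftrightarrow>
     (\<forall>t\<ge>0. X t \<in> borel_measurable M) \<and>
     (AE \<omega> in M. \<forall>t\<ge>0.
        (let \<mu> = interval_measure (\<lambda>s. E s \<omega>) in
           set_integrable \<mu> {0..t} (\<lambda>s. A *v X s \<omega>) \<and>
           set_integrable \<mu> {0..t} (\<lambda>s. f (E s \<omega>) (X s \<omega>)) \<and>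
           X t \<omega> = x0 + (LINT s:{0..t}|\<mu>. A *v X s \<omega>)
                       + (LINT s:{0..t}|\<mu>. f (E s \<omega>) (X s \<omega>))))"

text \<open>No condition on \<open>f\<close> guaranteeing well-posedness is imposed. Both notions of stability therefore
  ask for a global solution from every initial value, and for the bound along every such solution;
  when solutions are unique this is the bound for the solution.\<close>

definition exponentially_stable ::
  "real^'n^'n \<Rightarrow> (real \<Rightarrow> real^'n \<Rightarrow> real^'n) \<Rightarrow> bool" where
  "exponentially_stable A f \<longleftrightarrow>
     (\<exists>K>0. \<exists>\<gamma>>0. \<forall>x0.
        (\<exists>Y. ode_solution A f x0 Y) \<and>
        (\<forall>Y. ode_solution A f x0 Y \<longrightarrow> (\<forall>t\<ge>0. norm (Y t) \<le> K * norm x0 * exp (- \<gamma> * t))))"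

text \<open>The moment is a nonnegative Lebesgue integral, so the bound includes its finiteness.\<close>

definition moment_asymptotically_stable ::
  "real \<Rightarrow> 'a measure \<Rightarrow> (real \<Rightarrow> 'a \<Rightarrow> real) \<Rightarrow> real^'n^'n \<Rightarrow>
   (real \<Rightarrow> real^'n \<Rightarrow> real^'n) \<Rightarrow> bool" where
  "moment_asymptotically_stable p M E A f \<longleftrightarrow>
     (\<exists>(\<nu>::real \<Rightarrow> real) K. (\<forall>t\<ge>0. 0 \<le> \<nu> t) \<and> (\<nu> \<longlongrightarrow> 0) at_top \<and> 0 < K \<and>
        (\<forall>x0.
           (\<exists>X. time_changed_solution M E A f x0 X) \<and>
           (\<forall>X. time_changed_solution M E A f x0 X \<longrightarrow>
              (\<forall>t\<ge>0. (\<integral>\<^sup>+\<omega>. ennreal (norm (X t \<omega>) powr p) \<partial>M)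
                        \<le> ennreal (K * norm x0 powr p * \<nu> t)))))"

end

theory Submission
  imports Defs
begin

text \<open>The time-changed equation is the original equation read along the clock \<open>E\<close>. For almost every
  \<open>\<omega>\<close> the path \<open>u = U(\<cdot>, \<omega>)\<close> starts at \<open>0\<close>, is strictly increasing, right-continuous and unbounded,
  and then the Lebesgue--Stieltjes measure of its inverse \<open>E\<close> is the image of Lebesgue measure on
  \<open>[0, \<infinity>)\<close> under \<open>u\<close> (\<open>interval_measure_first_passage\<close>). This gives the substitution rule
  \<open>\<integral>\<^bsub>[0,t]\<^esub> F(s) dE\<^sub>s = \<integral>\<^bsub>[0,E\<^sub>t]\<^esub> F(u(v)) dv\<close> for vector-valued integrands (\<open>time_change\<close>). As
  \<open>E(u(v)) = v\<close>, it follows that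

  \<^item> if \<open>Y\<close> solves the original equation, then \<open>Y(E\<^sub>t)\<close> solves the time-changed one;
  \<^item> if \<open>x\<close> is a path solving the time-changed equation, then \<open>y = x \<circ> u\<close> solves the original one,
    and \<open>x(t) = y(E\<^sub>t)\<close>.

  The second point carries the pathwise bound: whichever solution \<open>X\<close> is chosen, and although the
  solution of the original equation that it comes from may vary with \<open>\<omega>\<close>,
  \<open>\<parallel>X\<^sub>t\<parallel> \<le> K \<parallel>x\<^sub>0\<parallel> exp(-\<gamma> E\<^sub>t)\<close> almost surely. Taking \<open>p\<close>th moments, the decay function is
  \<open>\<nu>(t) = \<bbbE>[exp(-\<gamma> p E\<^sub>t)]\<close>. It tends to \<open>0\<close> by dominated convergence, because \<open>E\<^sub>t \<rightarrow> \<infinity>\<close>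
  on every such path.

  That the paths of \<open>U\<close> are unbounded is a consequence of the stable law: the Laplace transform at
  \<open>s = 1\<close> is \<open>exp(-t)\<close>, so Markov's inequality makes \<open>U(n) \<le> k\<close> for all \<open>n\<close> a null event.\<close>

section \<open>First passage times of an increasing path\<close>

definition first_passage :: "(real \<Rightarrow> real) \<Rightarrow> real \<Rightarrow> real" where
  "first_passage u t = Inf {s. 0 < s \<and> t < u s}"

locale subordinator_path =
  fixes u :: "real \<Rightarrow> real"
  assumes start: "u 0 = 0"
    and strict_mono: "strict_mono_on {0..} u"
    and right_cont: "\<And>t. 0 \<le> t \<Longrightarrow> continuous (at_right t) u"
    and unbounded: "\<And>B. \<exists>s\<ge>0. B < u s"
begin

abbreviation E :: "real \<Rightarrow> real" where "E \<equiv> first_passage u"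

lemma path_less: "0 \<le> a \<Longrightarrow> a < b \<Longrightarrow> u a < u b"
  using strict_mono by (auto simp: strict_mono_on_def)

lemma path_le: "0 \<le> a \<Longrightarrow> a \<le> b \<Longrightarrow> u a \<le> u b"
  using path_less by (cases "a = b") (auto intro: less_imp_le)

lemma path_nonneg: "0 \<le> v \<Longrightarrow> 0 \<le> u v"
  using path_le[of 0 v] start by simp

lemma passage_set_nonempty: "{s. 0 < s \<and> t < u s} \<noteq> {}"
proof -
  obtain s where "s \<ge> 0" "t < u s" using unbounded by blast
  then have "0 < s + 1 \<and> t < u (s + 1)" using path_less[of s "s + 1"] by auto
  then show ?thesis by blast
qed

lemma passage_set_bdd_below: "bdd_below {s. 0 < s \<and> t < u s}"
  by (rule bdd_belowI[of _ 0]) auto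

lemma first_passage_nonneg: "0 \<le> E t"
  unfolding first_passage_def by (rule cInf_greatest[OF passage_set_nonempty]) auto

text \<open>The Galois connection between \<open>u\<close> and its inverse. It reduces order statements about \<open>E\<close>, and
  later its measurability in \<open>\<omega>\<close>, to statements about single values of \<open>u\<close>.
  Right-continuity of \<open>u\<close> is what yields \<open>t \<le> u b\<close> from \<open>t < u s\<close> for all \<open>s > b\<close>.\<close>

lemma first_passage_le_iff:
  assumes "0 \<le> b"
  shows "E t \<le> b \<longleftrightarrow> t \<le> u b"
proof
  assume le: "E t \<le> b"
  have above: "t \<le> u s" if "b < s" for s
  proof -
    have "Inf {s. 0 < s \<and> t < u s} < s"
      using le that unfolding first_passage_def by simp
    then obtain s' where "0 < s'" "t < u s'" "s' < s"
      using cInf_less_iff[OF passage_set_nonempty passage_set_bdd_below] by blast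
    then show ?thesis using path_less[of s' s] by simp
  qed
  have "(u \<longlongrightarrow> u b) (at_right b)"
    using right_cont[OF assms] by (simp add: continuous_within)
  moreover have "eventually (\<lambda>s. t \<le> u s) (at_right b)"
    by (rule eventually_mono[OF eventually_at_right_less above])
  ultimately show "t \<le> u b"
    by (rule tendsto_lowerbound) simp
next
  assume le: "t \<le> u b"
  have "E t \<le> s" if "b < s" for s
    unfolding first_passage_def
    by (rule cInf_lower[OF _ passage_set_bdd_below]) (use le path_less[of b s] assms that in auto)
  then show "E t \<le> b" by (rule dense_ge)
qed

lemma le_path_first_passage: "t \<le> u (E t)"
  using first_passage_le_iff[OF first_passage_nonneg, of t t] by simp

lemma first_passage_path: "0 \<le> s \<Longrightarrow> E (u s) = s"
proof -
  assume s: "0 \<le> s"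
  have "\<not> E (u s) < s"
    using le_path_first_passage[of "u s"] path_less[OF first_passage_nonneg, of "u s" s] by auto
  moreover have "E (u s) \<le> s" using first_passage_le_iff[OF s] by simp
  ultimately show ?thesis by simp
qed

lemma mono_first_passage: "mono E"
proof
  fix s t :: real assume "s \<le> t"
  then have "s \<le> u (E t)" using le_path_first_passage[of t] by simp
  then show "E s \<le> E t" by (simp add: first_passage_le_iff[OF first_passage_nonneg])
qed

lemma less_path_if_first_passage_less:
  assumes "E t < s" shows "t < u s"
proof -
  have "t \<le> u (E t)" by (rule le_path_first_passage)
  also have "\<dots> < u s" by (rule path_less[OF first_passage_nonneg assms])
  finally show ?thesis .
qed

lemma right_cont_first_passage: "continuous (at_right t) E"
  unfolding continuous_within
proof (rule order_tendstoI)
  fix a assume a: "a < E t"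
  have "a < E x" if "t < x" for x
    using a monoD[OF mono_first_passage, of t x] that by simp
  then show "eventually (\<lambda>x. a < E x) (at_right t)"
    by (rule eventually_mono[OF eventually_at_right_less])
next
  fix a assume "E t < a"
  then obtain s where s: "E t < s" "s < a" using dense by blast
  have "0 \<le> s" using s(1) first_passage_nonneg[of t] by simp
  have "eventually (\<lambda>x. x < u s) (at_right t)"
    using less_path_if_first_passage_less[OF s(1)] by (auto simp: eventually_at_right_field)
  moreover have "E x < a" if "x < u s" for x
    using that first_passage_le_iff[OF \<open>0 \<le> s\<close>, of x] s(2) by simp
  ultimately show "eventually (\<lambda>x. E x < a) (at_right t)"
    by (rule eventually_mono)
qed

lemma first_passage_at_top: "filterlim E at_top at_top"
  unfolding filterlim_at_top
proof
  fix Z :: real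
  have "Z \<le> E x" if "u (max 0 Z) \<le> x" for x
    using monoD[OF mono_first_passage that] first_passage_path[of "max 0 Z"] by simp
  then show "eventually (\<lambda>x. Z \<le> E x) at_top"
    by (auto simp: eventually_at_top_linorder)
qed

lemma borel_measurable_first_passage [measurable]: "E \<in> borel_measurable borel"
  by (rule borel_measurable_mono[OF mono_first_passage])

section \<open>Substitution in the Stieltjes integral\<close>

lemma path_measurable: "u \<in> borel_measurable (restrict_space lborel {0..})"
proof -
  have "u \<in> borel_measurable (restrict_space borel {0..})"
    by (rule borel_measurable_mono_on_fnc) (auto intro!: mono_onI path_le)
  then show ?thesis
    by (simp cong: measurable_cong_sets add: sets_restrict_space)
qed

lemma first_passage_le_if_less_path: "0 \<le> v \<Longrightarrow> a < u v \<Longrightarrow> E a \<le> v"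
  using first_passage_le_iff by simp

lemma le_first_passage_if_path_le: "0 \<le> v \<Longrightarrow> u v \<le> b \<Longrightarrow> v \<le> E b"
  using monoD[OF mono_first_passage, of "u v" b] first_passage_path by simp

text \<open>Up to its end points, \<open>{v. a < u v \<le> b}\<close> is the interval from \<open>E a\<close> to \<open>E b\<close>; the end points
  depend on whether \<open>u\<close> jumps over \<open>a\<close> and \<open>b\<close>, but Lebesgue measure does not see them.\<close>

lemma interval_measure_first_passage:
  "interval_measure E = distr (restrict_space lborel {0..}) borel u" (is "_ = ?D")
proof (rule measure_eqI_generator_eq[where \<Omega> = UNIV and A = "\<lambda>i::nat. {- real i <.. real i}"
      and E = "range (\<lambda>(a::real, b). {a<..b})"])
  show "Int_stable (range (\<lambda>(a::real, b). {a<..b}))"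
    by (auto simp: Int_stable_def image_def Ioc_inj) metis
  show "range (\<lambda>(a::real, b). {a<..b}) \<subseteq> Pow UNIV" by simp
  show "sets (interval_measure E) = sigma_sets UNIV (range (\<lambda>(a::real, b). {a<..b}))"
    "sets ?D = sigma_sets UNIV (range (\<lambda>(a::real, b). {a<..b}))"
    by (simp_all add: borel_sigma_sets_Ioc)
  show "range (\<lambda>i::nat. {- real i <.. real i}) \<subseteq> range (\<lambda>(a::real, b). {a<..b})" by auto
  show "(\<Union>i::nat. {- real i <.. real i}) = UNIV"
  proof (intro equalityI subsetI)
    fix x :: real
    obtain n :: nat where "\<bar>x\<bar> < real n" using reals_Archimedean2 by blast
    then show "x \<in> (\<Union>i::nat. {- real i <.. real i})" by (auto simp: abs_less_iff intro!: exI[of _ n])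
  qed auto
  have Ioc: "emeasure (interval_measure E) {a<..b} = ennreal (E b - E a)" if "a \<le> b" for a b
    using that monoD[OF mono_first_passage] right_cont_first_passage
    by (intro emeasure_interval_measure_Ioc) auto
  show "emeasure (interval_measure E) {- real i <.. real i} \<noteq> \<infinity>" for i
    by (simp add: Ioc)
  fix X assume "X \<in> range (\<lambda>(a::real, b). {a<..b})"
  then obtain a b where X: "X = {a<..b}" by auto
  show "emeasure (interval_measure E) X = emeasure ?D X"
  proof (cases "a \<le> b")
    case False
    then show ?thesis by (simp add: X)
  next
    case True
    define S where "S = u -` {a<..b} \<inter> {0..}"
    have S_sets: "S \<in> sets borel"
      using measurable_sets[OF path_measurable, of "{a<..b}"]
      by (auto simp: S_def space_restrict_space sets_restrict_space_iff)
    have "emeasure ?D X = emeasure (restrict_space lborel {0..}) S"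
      using path_measurable by (subst emeasure_distr) (auto simp: X S_def space_restrict_space)
    also have "\<dots> = emeasure lborel S"
      by (rule emeasure_restrict_space) (auto simp: S_def)
    also have "\<dots> = ennreal (E b - E a)"
    proof (rule antisym)
      have "S \<subseteq> {E a..E b}"
        using first_passage_le_if_less_path le_first_passage_if_path_le by (auto simp: S_def)
      then have "emeasure lborel S \<le> emeasure lborel {E a..E b}" by (rule emeasure_mono) simp
      then show "emeasure lborel S \<le> ennreal (E b - E a)"
        using monoD[OF mono_first_passage True] by simp
      have "{E a<..<E b} \<subseteq> S"
      proof
        fix v assume v: "v \<in> {E a<..<E b}"
        then have "0 \<le> v" using first_passage_nonneg[of a] by simp
        moreover have "a < u v" using v less_path_if_first_passage_less by simp
        moreover have "u v \<le> b"
          using v first_passage_le_if_less_path[OF \<open>0 \<le> v\<close>, of b] by force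
        ultimately show "v \<in> S" by (simp add: S_def)
      qed
      then have "emeasure lborel {E a<..<E b} \<le> emeasure lborel S"
        using S_sets by (intro emeasure_mono) simp_all
      then show "ennreal (E b - E a) \<le> emeasure lborel S"
        using monoD[OF mono_first_passage True] by simp
    qed
    finally show ?thesis by (simp add: X Ioc[OF True])
  qed
qed

lemma time_change:
  fixes F :: "real \<Rightarrow> 'b::{banach, second_countable_topology}"
  assumes meas: "set_borel_measurable borel {0..t} F"
  shows "set_integrable (interval_measure E) {0..t} F
      \<longleftrightarrow> set_integrable lborel {0..E t} (\<lambda>v. F (u v))" (is ?int)
    and "(LINT s:{0..t}|interval_measure E. F s) = (LINT v:{0..E t}|lborel. F (u v))" (is ?eq)
proof -
  define G where "G s = indicator {0..t} s *\<^sub>R F s" for s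
  define H where "H v = indicator {0..} v *\<^sub>R G (u v)" for v :: real
  have G: "G \<in> borel_measurable borel"
    using meas by (simp add: G_def[abs_def] set_borel_measurable_def)
  \<comment> \<open>At \<open>v = E t\<close> itself \<open>u v\<close> may exceed \<open>t\<close>, so the two integrands can differ there.\<close>
  have H: "H v = indicator {0..E t} v *\<^sub>R F (u v)" if "v \<notin> {E t}" for v
  proof (cases "0 \<le> v")
    case True
    then have "u v \<le> t \<longleftrightarrow> v \<le> E t"
      using that le_first_passage_if_path_le[of v t] first_passage_le_if_less_path[of v t] by force
    then show ?thesis using True path_nonneg by (auto simp: H_def G_def indicator_def)
  qed (simp add: H_def)
  have "integrable (interval_measure E) G \<longleftrightarrow> integrable lborel H"
    unfolding interval_measure_first_passage H_def
    using path_measurable G by (simp add: integrable_distr_eq integrable_restrict_space)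
  also have "\<dots> \<longleftrightarrow> set_integrable lborel {0..E t} (\<lambda>v. F (u v))"
    unfolding set_integrable_def by (rule integrable_discrete_difference[of "{E t}"]) (auto simp: H)
  finally show ?int by (simp add: set_integrable_def G_def[abs_def])
  have "integral\<^sup>L (interval_measure E) G = integral\<^sup>L lborel H"
    unfolding interval_measure_first_passage H_def
    using path_measurable G by (simp add: integral_distr integral_restrict_space)
  also have "\<dots> = (LINT v:{0..E t}|lborel. F (u v))"
    unfolding set_lebesgue_integral_def
    by (rule integral_discrete_difference[of "{E t}"]) (auto simp: H)
  finally show ?eq by (simp add: set_lebesgue_integral_def G_def[abs_def])
qed

lemma time_change_integrable:
  fixes F :: "real \<Rightarrow> 'b::{banach, second_countable_topology}"
  assumes "set_integrable (interval_measure E) {0..t} F"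
  shows "set_integrable lborel {0..E t} (\<lambda>v. F (u v))"
    and "(LINT s:{0..t}|interval_measure E. F s) = (LINT v:{0..E t}|lborel. F (u v))"
proof -
  have "set_borel_measurable borel {0..t} F"
    using borel_measurable_integrable[OF assms[unfolded set_integrable_def]]
    by (simp add: set_borel_measurable_def cong: measurable_cong_sets)
  then show "set_integrable lborel {0..E t} (\<lambda>v. F (u v))"
    "(LINT s:{0..t}|interval_measure E. F s) = (LINT v:{0..E t}|lborel. F (u v))"
    using time_change assms by auto
qed

text \<open>The converse direction, for integrands that depend on time only through the clock: these are
  measurable as soon as the outer function is.\<close>

lemma time_change_comp:
  fixes h :: "real \<Rightarrow> 'b::{banach, second_countable_topology}"
  assumes h: "set_integrable lborel {0..E t} h"
  shows "set_integrable (interval_measure E) {0..t} (\<lambda>s. h (E s))"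
    and "(LINT s:{0..t}|interval_measure E. h (E s)) = (LINT v:{0..E t}|lborel. h v)"
proof -
  have h_meas: "(\<lambda>v. indicator {0..E t} v *\<^sub>R h v) \<in> borel_measurable borel"
    using borel_measurable_integrable[OF h[unfolded set_integrable_def]] by simp
  have "(\<lambda>s. indicator {0..t} s *\<^sub>R (indicator {0..E t} (E s) *\<^sub>R h (E s))) \<in> borel_measurable borel"
    by (intro borel_measurable_scaleR
        measurable_compose[OF borel_measurable_first_passage h_meas]) simp
  also have "(\<lambda>s. indicator {0..t} s *\<^sub>R (indicator {0..E t} (E s) *\<^sub>R h (E s)))
      = (\<lambda>s. indicator {0..t} s *\<^sub>R h (E s))"
    using first_passage_nonneg monoD[OF mono_first_passage, of _ t]
    by (auto simp: fun_eq_iff indicator_def)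
  finally have meas: "set_borel_measurable borel {0..t} (\<lambda>s. h (E s))"
    by (simp add: set_borel_measurable_def)
  have "set_integrable lborel {0..E t} (\<lambda>v. h (E (u v)))
      \<longleftrightarrow> set_integrable lborel {0..E t} h"
    by (rule set_integrable_cong) (auto simp: first_passage_path)
  with h time_change(1)[OF meas]
  show "set_integrable (interval_measure E) {0..t} (\<lambda>s. h (E s))" by simp
  have "(LINT v:{0..E t}|lborel. h (E (u v))) = (LINT v:{0..E t}|lborel. h v)"
    by (rule set_lebesgue_integral_cong) (auto simp: first_passage_path)
  with time_change(2)[OF meas]
  show "(LINT s:{0..t}|interval_measure E. h (E s)) = (LINT v:{0..E t}|lborel. h v)" by simp
qed

end

section \<open>Duality between the two equations\<close>

text \<open>The requirement that \<^const>\<open>time_changed_solution\<close> places on almost every path.\<close>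

definition stieltjes_solution ::
  "(real \<Rightarrow> real) \<Rightarrow> real^'n^'n \<Rightarrow> (real \<Rightarrow> real^'n \<Rightarrow> real^'n) \<Rightarrow> real^'n \<Rightarrow>
   (real \<Rightarrow> real^'n) \<Rightarrow> bool" where
  "stieltjes_solution e A f x0 x \<longleftrightarrow>
     (\<forall>t\<ge>0. set_integrable (interval_measure e) {0..t} (\<lambda>s. A *v x s) \<and>
             set_integrable (interval_measure e) {0..t} (\<lambda>s. f (e s) (x s)) \<and>
             x t = x0 + (LINT s:{0..t}|interval_measure e. A *v x s)
                      + (LINT s:{0..t}|interval_measure e. f (e s) (x s)))"

context subordinator_path
begin

lemma stieltjes_solution_of_ode_solution:
  fixes Y :: "real \<Rightarrow> real^'n"
  assumes "ode_solution A f x0 Y"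
  shows "stieltjes_solution E A f x0 (\<lambda>t. Y (E t))"
  unfolding stieltjes_solution_def
proof (intro allI impI conjI)
  fix t :: real
  have A: "set_integrable lborel {0..E t} (\<lambda>s. A *v Y s)"
    and f: "set_integrable lborel {0..E t} (\<lambda>s. f s (Y s))"
    and Y: "Y (E t) = x0 + (LINT s:{0..E t}|lborel. A *v Y s) + (LINT s:{0..E t}|lborel. f s (Y s))"
    using assms first_passage_nonneg[of t] unfolding ode_solution_def by blast+
  show "set_integrable (interval_measure E) {0..t} (\<lambda>s. A *v Y (E s))"
    by (rule time_change_comp(1)[OF A])
  show "set_integrable (interval_measure E) {0..t} (\<lambda>s. f (E s) (Y (E s)))"
    by (rule time_change_comp(1)[OF f])
  show "Y (E t) = x0 + (LINT s:{0..t}|interval_measure E. A *v Y (E s))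
      + (LINT s:{0..t}|interval_measure E. f (E s) (Y (E s)))"
    using Y time_change_comp(2)[OF A] time_change_comp(2)[OF f] by simp
qed

text \<open>After substitution the right-hand side of the equation for \<open>x t\<close> depends on \<open>t\<close> only through
  \<open>E t\<close>. Evaluating it at \<open>t = u r\<close>, where \<open>E t = r\<close>, gives the equation for \<open>x \<circ> u\<close>; and \<open>x\<close> must
  agree at \<open>t\<close> and \<open>u (E t)\<close>, that is, it is constant where the clock stands still.\<close>

lemma ode_solution_of_stieltjes_solution:
  fixes x :: "real \<Rightarrow> real^'n"
  assumes "stieltjes_solution E A f x0 x"
  shows "ode_solution A f x0 (\<lambda>v. x (u v))"
    and "\<And>t. 0 \<le> t \<Longrightarrow> x t = x (u (E t))"
proof -
  have step: "set_integrable lborel {0..E t} (\<lambda>v. A *v x (u v)) \<and>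
      set_integrable lborel {0..E t} (\<lambda>v. f v (x (u v))) \<and>
      x t = x0 + (LINT v:{0..E t}|lborel. A *v x (u v)) + (LINT v:{0..E t}|lborel. f v (x (u v)))"
    if "0 \<le> t" for t
  proof -
    have A: "set_integrable (interval_measure E) {0..t} (\<lambda>s. A *v x s)"
      and f: "set_integrable (interval_measure E) {0..t} (\<lambda>s. f (E s) (x s))"
      and x: "x t = x0 + (LINT s:{0..t}|interval_measure E. A *v x s)
        + (LINT s:{0..t}|interval_measure E. f (E s) (x s))"
      using assms that unfolding stieltjes_solution_def by blast+
    have int: "set_integrable lborel {0..E t} (\<lambda>v. f (E (u v)) (x (u v)))
        \<longleftrightarrow> set_integrable lborel {0..E t} (\<lambda>v. f v (x (u v)))"
      by (rule set_integrable_cong) (auto simp: first_passage_path)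
    have eq: "(LINT v:{0..E t}|lborel. f (E (u v)) (x (u v)))
        = (LINT v:{0..E t}|lborel. f v (x (u v)))"
      by (rule set_lebesgue_integral_cong) (auto simp: first_passage_path)
    show ?thesis
      using x time_change_integrable[OF A] time_change_integrable[OF f] int eq by simp
  qed
  show sol: "ode_solution A f x0 (\<lambda>v. x (u v))"
    unfolding ode_solution_def
  proof (intro allI impI)
    fix r :: real assume "0 \<le> r"
    then show "set_integrable lborel {0..r} (\<lambda>v. A *v x (u v)) \<and>
      set_integrable lborel {0..r} (\<lambda>v. f v (x (u v))) \<and>
      x (u r) = x0 + (LINT v:{0..r}|lborel. A *v x (u v)) + (LINT v:{0..r}|lborel. f v (x (u v)))"
      using step[OF path_nonneg[OF \<open>0 \<le> r\<close>]] by (simp add: first_passage_path)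
  qed
  fix t :: real assume "0 \<le> t"
  then show "x t = x (u (E t))"
    using step[OF \<open>0 \<le> t\<close>] sol first_passage_nonneg[of t] unfolding ode_solution_def by metis
qed

end

text \<open>The equation determines \<open>Y\<close> only on \<open>[0, \<infinity>)\<close>; its values at negative times are arbitrary and are
  cut off.\<close>

lemma ode_solution_measurable:
  fixes Y :: "real \<Rightarrow> real^'n"
  assumes "ode_solution A f x0 Y"
  shows "(\<lambda>t. Y (max 0 t)) \<in> borel_measurable borel"
proof -
  have cont: "continuous_on {0..T} Y" if "0 \<le> T" for T
  proof -
    let ?g = "\<lambda>s. A *v Y s" and ?h = "\<lambda>s. f s (Y s)"
    have int: "set_integrable lborel {0..t} ?g" "set_integrable lborel {0..t} ?h" if "0 \<le> t" for t
      using assms that unfolding ode_solution_def by blast+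
    have eq: "x0 + integral {0..t} ?g + integral {0..t} ?h = Y t" if "t \<in> {0..T}" for t
      using assms that int[THEN set_borel_integral_eq_integral(2)] unfolding ode_solution_def by auto
    have "continuous_on {0..T} (\<lambda>t. x0 + integral {0..t} ?g + integral {0..t} ?h)"
      using int[OF that, THEN set_borel_integral_eq_integral(1)]
      by (intro continuous_intros indefinite_integral_continuous_1)
    then show ?thesis by (rule continuous_on_eq) (rule eq)
  qed
  have "continuous_on UNIV (\<lambda>t. Y (max 0 t))"
    unfolding continuous_on_eq_continuous_at[OF open_UNIV]
  proof
    fix t :: real
    have "continuous_on {..<\<bar>t\<bar> + 1} (\<lambda>t. Y (max 0 t))"
      by (rule continuous_on_compose2[OF cont[of "\<bar>t\<bar> + 1"]]) (auto intro!: continuous_intros)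
    then show "isCont (\<lambda>t. Y (max 0 t)) t"
      by (rule continuous_on_interior) (simp add: interior_open)
  qed
  then show ?thesis by (rule borel_measurable_continuous_onI)
qed

section \<open>Paths of the stable subordinator\<close>

lemma stable_subordinator_unbounded:
  assumes "prob_space M" and U: "stable_subordinator M \<beta> U"
  shows "AE \<omega> in M. \<forall>k::nat. \<exists>n::nat. real k < U (real n) \<omega>"
proof -
  interpret prob_space M by fact
  have meas [measurable]: "U (real n) \<in> borel_measurable M" for n :: nat
    using U by (simp add: stable_subordinator_def levy_process_def)
  have laplace: "expectation (\<lambda>\<omega>. exp (- U (real n) \<omega>)) = exp (- real n)" for n :: nat
  proof -
    have "\<forall>t\<ge>0. \<forall>s\<ge>0. expectation (\<lambda>\<omega>. exp (- s * U t \<omega>)) = exp (- t * s powr \<beta>)"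
      using U by (simp add: stable_subordinator_def)
    from this[rule_format, of "real n" 1] show ?thesis by simp
  qed
  have "AE \<omega> in M. \<exists>n::nat. real k < U (real n) \<omega>" for k :: nat
  proof -
    define S where "S = {\<omega> \<in> space M. \<forall>n::nat. U (real n) \<omega> \<le> real k}"
    have S [measurable]: "S \<in> events" unfolding S_def by measurable
    have bound: "prob S \<le> exp (real k) * exp (- real n)" for n :: nat
    proof -
      \<comment> \<open>A non-integrable function would have expectation \<open>0\<close>.\<close>
      have int: "integrable M (\<lambda>\<omega>. exp (- U (real n) \<omega>))"
        using laplace[of n] not_integrable_integral_eq by fastforce
      have int_S: "integrable M (\<lambda>\<omega>. exp (- real k) * indicator S \<omega>)"
        using S by (intro integrable_mult_right integrable_real_indicator)
          (auto simp: emeasure_eq_measure)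
      have "exp (- real k) * prob S = expectation (\<lambda>\<omega>. exp (- real k) * indicator S \<omega>)"
        by simp
      also have "\<dots> \<le> expectation (\<lambda>\<omega>. exp (- U (real n) \<omega>))"
        by (intro integral_mono int int_S) (auto simp: S_def indicator_def)
      finally have "exp (real k) * (exp (- real k) * prob S) \<le> exp (real k) * exp (- real n)"
        by (simp add: laplace)
      then show ?thesis by (simp add: mult.assoc[symmetric] exp_add[symmetric])
    qed
    have "(\<lambda>n. exp (real k) * exp (- real n)) \<longlonglongrightarrow> exp (real k) * 0"
      by (intro tendsto_mult tendsto_const filterlim_compose[OF exp_at_bot]
          filterlim_compose[OF filterlim_uminus_at_bot_at_top filterlim_real_sequentially])
    then have "prob S \<le> exp (real k) * 0"
      by (rule LIMSEQ_le_const) (use bound in blast)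
    then have "S \<in> null_sets M"
      using S measure_nonneg[of M S] by (simp add: emeasure_eq_measure null_sets_def)
    then show ?thesis
      by (rule AE_I') (auto simp: S_def not_less)
  qed
  then show ?thesis by (simp add: AE_all_countable)
qed

lemma stable_subordinator_paths:
  assumes "prob_space M" and U: "stable_subordinator M \<beta> U"
  shows "AE \<omega> in M. subordinator_path (\<lambda>t. U t \<omega>)"
proof -
  have "AE \<omega> in M. U 0 \<omega> = 0"
    "AE \<omega> in M. (\<forall>t\<ge>0. continuous (at_right t) (\<lambda>s. U s \<omega>)) \<and>
       (\<forall>t>0. \<exists>l. ((\<lambda>s. U s \<omega>) \<longlongrightarrow> l) (at_left t))"
    "AE \<omega> in M. strict_mono_on {0..} (\<lambda>t. U t \<omega>)"
    using U by (auto simp: stable_subordinator_def levy_process_def)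
  with stable_subordinator_unbounded[OF assms] show ?thesis
  proof eventually_elim
    case (elim \<omega>)
    show ?case
    proof
      fix B :: real
      obtain k :: nat where "B < real k" using reals_Archimedean2 by blast
      moreover obtain n :: nat where "real k < U (real n) \<omega>" using elim by blast
      ultimately show "\<exists>s\<ge>0. B < U s \<omega>" by (intro exI[of _ "real n"]) auto
    qed (use elim in auto)
  qed
qed

section \<open>Moment stability\<close>

lemma inverse_subordinator_eq: "inverse_subordinator U t \<omega> = first_passage (\<lambda>s. U s \<omega>) t"
  by (simp add: inverse_subordinator_def first_passage_def)

lemma time_changed_solution_iff:
  "time_changed_solution M (inverse_subordinator U) A f x0 X \<longleftrightarrow>
     (\<forall>t\<ge>0. X t \<in> borel_measurable M) \<and>
     (AE \<omega> in M. stieltjes_solution (first_passage (\<lambda>s. U s \<omega>)) A f x0 (\<lambda>t. X t \<omega>))"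
  by (simp add: time_changed_solution_def stieltjes_solution_def inverse_subordinator_eq[abs_def]
      Let_def)

text \<open>On the exceptional paths the infimum need not be measurable in \<open>\<omega>\<close>, and \<open>M\<close> need not be
  complete. The clock is therefore reset to \<open>0\<close> off a measurable set \<open>G\<close> of good paths.\<close>

lemma measurable_first_passage_on:
  assumes U: "\<And>s. 0 \<le> s \<Longrightarrow> U s \<in> borel_measurable M"
    and G: "G \<in> sets M" "\<And>\<omega>. \<omega> \<in> G \<Longrightarrow> subordinator_path (\<lambda>s. U s \<omega>)"
  shows "(\<lambda>\<omega>. if \<omega> \<in> G then first_passage (\<lambda>s. U s \<omega>) t else 0) \<in> borel_measurable M"
    (is "?E \<in> _")
  unfolding borel_measurable_iff_le
proof
  fix b :: real
  show "{\<omega> \<in> space M. ?E \<omega> \<le> b} \<in> sets M"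
  proof (cases "0 \<le> b")
    case True
    have [measurable]: "U b \<in> borel_measurable M" "G \<in> sets M" using U[OF True] G(1) by auto
    have "{\<omega> \<in> space M. ?E \<omega> \<le> b} = {\<omega> \<in> space M. \<omega> \<in> G \<longrightarrow> t \<le> U b \<omega>}"
      using True subordinator_path.first_passage_le_iff[OF G(2)] by auto
    also have "\<dots> \<in> sets M" by measurable
    finally show ?thesis .
  next
    case False
    have "0 \<le> ?E \<omega>" for \<omega> using subordinator_path.first_passage_nonneg[OF G(2)] by simp
    then have "\<not> ?E \<omega> \<le> b" for \<omega>
      using False order_trans by blast
    then have "{\<omega> \<in> space M. ?E \<omega> \<le> b} = {}" by blast
    then show ?thesis by (simp only: sets.empty_sets)
  qed
qed

theorem corollary3p1:
  fixes M :: "'a measure"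
    and U :: "real \<Rightarrow> 'a \<Rightarrow> real"
    and \<beta> :: real
    and A :: "real^'n^'n"
    and f :: "real \<Rightarrow> real^'n \<Rightarrow> real^'n"
  assumes "prob_space M"
    and "0 < \<beta>" and "\<beta> < 1"
    and "stable_subordinator M \<beta> U"
    and "\<forall>\<mu>\<in>spectrum A. Re \<mu> < 0"
    and "\<forall>t\<ge>0. f t 0 = 0"
    and "exponentially_stable A f"
  shows "\<forall>p\<ge>1. moment_asymptotically_stable p M (inverse_subordinator U) A f"
proof (intro allI impI)
  fix p :: real assume p: "1 \<le> p"
  interpret prob_space M by fact
  have U: "U s \<in> borel_measurable M" if "0 \<le> s" for s
    using assms(4) that by (simp add: stable_subordinator_def levy_process_def)
  have paths: "AE \<omega> in M. subordinator_path (\<lambda>s. U s \<omega>)"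
    by (rule stable_subordinator_paths[OF assms(1,4)])
  then obtain N where N: "{\<omega> \<in> space M. \<not> subordinator_path (\<lambda>s. U s \<omega>)} \<subseteq> N" "N \<in> null_sets M"
    by (auto simp: eventually_ae_filter)
  define G where "G = space M - N"
  have G: "G \<in> sets M" "\<And>\<omega>. \<omega> \<in> G \<Longrightarrow> subordinator_path (\<lambda>s. U s \<omega>)"
    using N by (auto simp: G_def)
  have AE_G: "AE \<omega> in M. \<omega> \<in> G"
    using N(2) by (intro AE_I'[of N]) (auto simp: G_def)
  define E where "E t \<omega> = (if \<omega> \<in> G then first_passage (\<lambda>s. U s \<omega>) t else 0)" for t \<omega>
  have E_meas [measurable]: "E t \<in> borel_measurable M" for t
    unfolding E_def using U G by (rule measurable_first_passage_on)
  have E_nonneg: "0 \<le> E t \<omega>" for t \<omega>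
    using subordinator_path.first_passage_nonneg[OF G(2)] by (simp add: E_def)

  obtain K \<gamma> where K: "0 < K" and \<gamma>: "0 < \<gamma>"
    and ex: "\<And>x0. \<exists>Y. ode_solution A f x0 Y"
    and decay: "\<And>x0 Y t. ode_solution A f x0 Y \<Longrightarrow> 0 \<le> t
      \<Longrightarrow> norm (Y t) \<le> K * norm x0 * exp (- \<gamma> * t)"
    using assms(7) unfolding exponentially_stable_def by blast

  define \<nu> where "\<nu> t = expectation (\<lambda>\<omega>. exp (- (\<gamma> * p * E t \<omega>)))" for t
  have le1: "exp (- (\<gamma> * p * E t \<omega>)) \<le> 1" for t \<omega>
    using \<gamma> p E_nonneg by simp
  have int: "integrable M (\<lambda>\<omega>. exp (- (\<gamma> * p * E t \<omega>)))" for t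
    by (rule integrable_const_bound[where B = 1]) (use le1 in auto)
  have \<nu>_lim: "(\<nu> \<longlongrightarrow> 0) at_top"
  proof -
    have "((\<lambda>t. expectation (\<lambda>\<omega>. exp (- (\<gamma> * p * E t \<omega>)))) \<longlongrightarrow> expectation (\<lambda>\<omega>. 0)) at_top"
    proof (rule integral_dominated_convergence_at_top[where w = "\<lambda>_. 1"])
      show "AE \<omega> in M. ((\<lambda>t. exp (- (\<gamma> * p * E t \<omega>))) \<longlongrightarrow> 0) at_top"
        using AE_G
      proof eventually_elim
        case (elim \<omega>)
        have "filterlim (\<lambda>t. E t \<omega>) at_top at_top"
          using elim subordinator_path.first_passage_at_top[OF G(2)] by (simp add: E_def)
        then have "filterlim (\<lambda>t. \<gamma> * p * E t \<omega>) at_top at_top"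
          using \<gamma> p by (intro filterlim_tendsto_pos_mult_at_top[OF tendsto_const]) auto
        then show ?case
          by (intro filterlim_compose[OF exp_at_bot]
              filterlim_compose[OF filterlim_uminus_at_bot_at_top])
      qed
    qed (use le1 in auto)
    then show ?thesis by (simp add: \<nu>_def[abs_def])
  qed

  have existence: "\<exists>X. time_changed_solution M (inverse_subordinator U) A f x0 X" for x0
  proof -
    obtain Y where Y: "ode_solution A f x0 Y" using ex by blast
    have "(\<lambda>\<omega>. Y (E t \<omega>)) \<in> borel_measurable M" for t
      using measurable_compose[OF E_meas ode_solution_measurable[OF Y], of t] E_nonneg
      by (simp add: max_absorb2)
    moreover have "AE \<omega> in M. stieltjes_solution (first_passage (\<lambda>s. U s \<omega>)) A f x0 (\<lambda>t. Y (E t \<omega>))"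
      using AE_G
      by eventually_elim
        (use subordinator_path.stieltjes_solution_of_ode_solution[OF G(2) Y] in \<open>simp add: E_def\<close>)
    ultimately show ?thesis
      by (auto simp: time_changed_solution_iff intro!: exI[of _ "\<lambda>t \<omega>. Y (E t \<omega>)"])
  qed

  have bound: "(\<integral>\<^sup>+\<omega>. ennreal (norm (X t \<omega>) powr p) \<partial>M) \<le> ennreal (K powr p * norm x0 powr p * \<nu> t)"
    if X: "time_changed_solution M (inverse_subordinator U) A f x0 X" and t: "0 \<le> t" for x0 X t
  proof -
    let ?c = "K powr p * norm x0 powr p"
    have "AE \<omega> in M. stieltjes_solution (first_passage (\<lambda>s. U s \<omega>)) A f x0 (\<lambda>t. X t \<omega>)"
      using X by (simp add: time_changed_solution_iff)
    with AE_G have "AE \<omega> in M. norm (X t \<omega>) powr p \<le> ?c * exp (- (\<gamma> * p * E t \<omega>))"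
    proof eventually_elim
      case (elim \<omega>)
      interpret path: subordinator_path "\<lambda>s. U s \<omega>" using elim(1) by (rule G(2))
      note sol = path.ode_solution_of_stieltjes_solution[OF elim(2)]
      have "norm (X t \<omega>) = norm (X (U (E t \<omega>) \<omega>) \<omega>)"
        using sol(2)[OF t] elim(1) by (simp add: E_def)
      also have "\<dots> \<le> K * norm x0 * exp (- \<gamma> * E t \<omega>)"
        by (rule decay[OF sol(1) E_nonneg])
      finally have "norm (X t \<omega>) powr p \<le> (K * norm x0 * exp (- \<gamma> * E t \<omega>)) powr p"
        using p by (intro powr_mono2) auto
      also have "\<dots> = ?c * exp (- (\<gamma> * p * E t \<omega>))"
        using K by (simp add: powr_mult powr_def[of "exp _"] mult_ac)
      finally show ?case .
    qed
    then have "(\<integral>\<^sup>+\<omega>. ennreal (norm (X t \<omega>) powr p) \<partial>M)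
        \<le> (\<integral>\<^sup>+\<omega>. ennreal (?c * exp (- (\<gamma> * p * E t \<omega>))) \<partial>M)"
      by (intro nn_integral_mono_AE) (auto intro: ennreal_leI elim: eventually_mono)
    also have "\<dots> = ennreal (?c * \<nu> t)"
      using int[of t] by (subst nn_integral_eq_integral) (auto simp: \<nu>_def)
    finally show ?thesis .
  qed

  have "\<forall>t\<ge>0. 0 \<le> \<nu> t" by (simp add: \<nu>_def)
  moreover have "0 < K powr p" using K by simp
  ultimately show "moment_asymptotically_stable p M (inverse_subordinator U) A f"
    unfolding moment_asymptotically_stable_def using \<nu>_lim existence bound by blast
qed

end
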